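(* Let $\lambda,\alpha\in\mathbb{C}^*$. Let $\Omega(\lambda,\alpha)=\mathbb{C}[x,y]\oplus\mathbb{C}[s,t]$ be the $\mathbb{Z}_2$-graded vector space with even part $\Omega(\lambda,\alpha)_{\bar 0}=\mathbb{C}[x,y]$ and odd part $\Omega(\lambda,\alpha)_{\bar 1}=\mathbb{C}[s,t]$. Then $\Omega(\lambda,\alpha)$ is a module over the Ramond $N=2$ superconformal algebra $\mathcal{R}$ under the action given, for $m\in\mathbb{Z}$, $f(x,y)\in\mathbb{C}[x,y]$, $g(s,t)\in\mathbb{C}[s,t]$, by $$L_m f(x,y)=\lambda^m\left(x+\tfrac12 my\right)f(x+m,y),\qquad L_m g(s,t)=\lambda^m\left(s+\tfrac12 mt+m\right)g(s+m,t),$$ $$H_m f(x,y)=\lambda^m y f(x+m,y),\qquad H_m g(s,t)=\lambda^m t g(s+m,t),$$ $$G_m^+ f(x,y)=0,\qquad G_m^+ g(s,t)=\lambda^m\tfrac{2}{\alpha}(x+my)g(x+m,y-1),$$ $$G_m^- f(x,y)=\lambda^m\alpha f(s+m,t+1),\qquad G_m^- g(s,t)=0,$$ $$Cf(x,y)=Cg(s,t)=0.$$ Moreover, $\Omega(\lambda,\alpha)$ is free of rank $2$ as a module over $\mathbb{C}[L_0,H_0]$.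
   Context: The base field is $\mathbb{C}$; $\mathbb{C}^*$ is the set of nonzero complex numbers. The Ramond $N=2$ superconformal algebra $\mathcal{R}$ is the Lie superalgebra with basis $\{L_m,H_m,G_m^{+},G_m^{-},C\mid m\in\mathbb{Z}\}$, where $L_m,H_m,C$ are even, $G_m^{\pm}$ are odd, and, for $m,n,r,s\in\mathbb{Z}$, $[L_m,L_n]=(m-n)L_{m+n}+\frac1{12}(m^3-m)\delta_{m+n,0}C$, $[L_m,H_n]=-nH_{m+n}$, $[H_m,H_n]=\frac13 m\delta_{m+n,0}C$, $[L_m,G_r^{\pm}]=(\frac12 m-r)G_{m+r}^{\pm}$, $[H_m,G_r^{\pm}]=\pm G_{m+r}^{\pm}$, $[G_r^-,G_s^+]=2L_{r+s}-(r-s)H_{r+s}+\frac13(r^2-\frac14)\delta_{r+s,0}C$, $[G_r^+,G_s^+]=[G_r^-,G_s^-]=0$, $[\mathcal{R},C]=0$. A module over a Lie superalgebra always means a supermodule ($\mathbb{Z}_2$-graded, with the action compatible with the grading). $\mathfrak{h}=\mathbb{C}L_0\oplus\mathbb{C}H_0$ is the Cartan subalgebra (modulo the center), and $U(\mathfrak{h})=\mathbb{C}[L_0,H_0]$ since $[L_0,H_0]=0$. *)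

theory Defs
  imports
    Complex_Main
    "HOL-Library.Poly_Mapping"
    "HOL-Library.Product_Plus"
    "HOL-Library.Z2"
    "HOL-Computational_Algebra.Polynomial"
begin

section \<open>Lie superalgebras and their supermodules\<close>

definition super_sign :: "bit \<Rightarrow> bit \<Rightarrow> complex" where
  "super_sign i j = (if i = 1 \<and> j = 1 then - 1 else 1)"

locale super_vector_space = vector_space scale
  for scale :: "complex \<Rightarrow> 'v::ab_group_add \<Rightarrow> 'v" +
  fixes part :: "bit \<Rightarrow> 'v set"
  assumes subspace_part: "\<And>i. subspace (part i)"
    and part_sum: "\<And>v. \<exists>v0 \<in> part 0. \<exists>v1 \<in> part 1. v = v0 + v1"
    and part_disjoint: "part 0 \<inter> part 1 = {0}"

locale lie_superalgebra = super_vector_space scale part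
  for scale :: "complex \<Rightarrow> 'g::ab_group_add \<Rightarrow> 'g" and part :: "bit \<Rightarrow> 'g set" +
  fixes bracket :: "'g \<Rightarrow> 'g \<Rightarrow> 'g"
  assumes linear_bracket_left: "\<And>b. Vector_Spaces.linear scale scale (\<lambda>a. bracket a b)"
    and linear_bracket_right: "\<And>a. Vector_Spaces.linear scale scale (bracket a)"
    and bracket_part: "\<And>i j a b. a \<in> part i \<Longrightarrow> b \<in> part j \<Longrightarrow> bracket a b \<in> part (i + j)"
    and super_skew: "\<And>i j a b. a \<in> part i \<Longrightarrow> b \<in> part j \<Longrightarrow>
          bracket a b = scale (- super_sign i j) (bracket b a)"
    and super_jacobi: "\<And>i j a b c. a \<in> part i \<Longrightarrow> b \<in> part j \<Longrightarrow>
          bracket a (bracket b c) =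
            bracket (bracket a b) c + scale (super_sign i j) (bracket b (bracket a c))"

locale lie_supermodule =
  g: lie_superalgebra gscale gpart bracket + super_vector_space vscale vpart
  for gscale :: "complex \<Rightarrow> 'g::ab_group_add \<Rightarrow> 'g" and gpart :: "bit \<Rightarrow> 'g set"
    and bracket :: "'g \<Rightarrow> 'g \<Rightarrow> 'g"
    and vscale :: "complex \<Rightarrow> 'v::ab_group_add \<Rightarrow> 'v" and vpart :: "bit \<Rightarrow> 'v set" +
  fixes act :: "'g \<Rightarrow> 'v \<Rightarrow> 'v"
  assumes linear_act_left: "\<And>v. Vector_Spaces.linear gscale vscale (\<lambda>a. act a v)"
    and linear_act_right: "\<And>a. Vector_Spaces.linear vscale vscale (act a)"
    and act_part: "\<And>i j a v. a \<in> gpart i \<Longrightarrow> v \<in> vpart j \<Longrightarrow> act a v \<in> vpart (i + j)"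
    and act_bracket: "\<And>i j a b v. a \<in> gpart i \<Longrightarrow> b \<in> gpart j \<Longrightarrow>
          act (bracket a b) v =
            act a (act b v) - vscale (super_sign i j) (act b (act a v))"

text \<open>The linear extension of a family of vectors indexed by a basis to the space of
  finitely supported functions on that basis.\<close>

definition lin_ext ::
  "(complex \<Rightarrow> 'v::ab_group_add \<Rightarrow> 'v) \<Rightarrow> ('b \<Rightarrow> 'v) \<Rightarrow> ('b \<Rightarrow>\<^sub>0 complex) \<Rightarrow> 'v" where
  "lin_ext scale f a =
    (\<Sum>b\<in>Poly_Mapping.keys a. scale (Poly_Mapping.lookup a b) (f b))"


section \<open>The Ramond N=2 superconformal algebra\<close>

datatype ramond_basis = Lgen int | Hgen int | Gplus int | Gminus int | Cgen

type_synonym ramond = "ramond_basis \<Rightarrow>\<^sub>0 complex"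

fun parity :: "ramond_basis \<Rightarrow> bit" where
  "parity (Gplus m) = 1"
| "parity (Gminus m) = 1"
| "parity _ = 0"

definition ramond_scale :: "complex \<Rightarrow> ramond \<Rightarrow> ramond" where
  "ramond_scale c = Poly_Mapping.map ((*) c)"

definition ramond_part :: "bit \<Rightarrow> ramond set" where
  "ramond_part i = {a. \<forall>b\<in>Poly_Mapping.keys a. parity b = i}"

text \<open>\<open>ramond_term c b\<close> is \<open>c\<close> times the basis vector \<open>b\<close>.\<close>

abbreviation ramond_term :: "complex \<Rightarrow> ramond_basis \<Rightarrow> ramond" where
  "ramond_term c b \<equiv> Poly_Mapping.single b c"

fun basis_bracket :: "ramond_basis \<Rightarrow> ramond_basis \<Rightarrow> ramond" where
  "basis_bracket (Lgen m) (Lgen n) =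
     ramond_term (of_int (m - n)) (Lgen (m + n)) +
     ramond_term (if m + n = 0 then 1/12 * of_int (m^3 - m) else 0) Cgen"
| "basis_bracket (Lgen m) (Hgen n) = ramond_term (- of_int n) (Hgen (m + n))"
| "basis_bracket (Hgen n) (Lgen m) = ramond_term (of_int n) (Hgen (m + n))"
| "basis_bracket (Hgen m) (Hgen n) =
     ramond_term (if m + n = 0 then 1/3 * of_int m else 0) Cgen"
| "basis_bracket (Lgen m) (Gplus r) = ramond_term (of_int m / 2 - of_int r) (Gplus (m + r))"
| "basis_bracket (Gplus r) (Lgen m) = ramond_term (- (of_int m / 2 - of_int r)) (Gplus (m + r))"
| "basis_bracket (Lgen m) (Gminus r) = ramond_term (of_int m / 2 - of_int r) (Gminus (m + r))"
| "basis_bracket (Gminus r) (Lgen m) = ramond_term (- (of_int m / 2 - of_int r)) (Gminus (m + r))"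
| "basis_bracket (Hgen m) (Gplus r) = ramond_term 1 (Gplus (m + r))"
| "basis_bracket (Gplus r) (Hgen m) = ramond_term (- 1) (Gplus (m + r))"
| "basis_bracket (Hgen m) (Gminus r) = ramond_term (- 1) (Gminus (m + r))"
| "basis_bracket (Gminus r) (Hgen m) = ramond_term 1 (Gminus (m + r))"
| "basis_bracket (Gminus r) (Gplus s) =
     ramond_term 2 (Lgen (r + s)) - ramond_term (of_int (r - s)) (Hgen (r + s)) +
     ramond_term (if r + s = 0 then 1/3 * (of_int r ^ 2 - 1/4) else 0) Cgen"
| "basis_bracket (Gplus s) (Gminus r) =
     ramond_term 2 (Lgen (r + s)) - ramond_term (of_int (r - s)) (Hgen (r + s)) +
     ramond_term (if r + s = 0 then 1/3 * (of_int r ^ 2 - 1/4) else 0) Cgen"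
| "basis_bracket (Gplus r) (Gplus s) = 0"
| "basis_bracket (Gminus r) (Gminus s) = 0"
| "basis_bracket Cgen _ = 0"
| "basis_bracket _ Cgen = 0"

definition ramond_bracket :: "ramond \<Rightarrow> ramond \<Rightarrow> ramond" where
  "ramond_bracket a b =
    lin_ext ramond_scale (\<lambda>i. lin_ext ramond_scale (basis_bracket i) b) a"


text \<open>The table above does define a Lie superalgebra.\<close>

lemma lookup_ramond_scale [simp]:
  "Poly_Mapping.lookup (ramond_scale c a) b = c * Poly_Mapping.lookup a b"
  by (simp add: ramond_scale_def Poly_Mapping.map.rep_eq when_def)

lemma vector_space_ramond: "vector_space ramond_scale"
  by unfold_locales (auto intro!: poly_mapping_eqI simp: lookup_add algebra_simps)

interpretation ramond: vector_space ramond_scale by (rule vector_space_ramond)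

lemma lin_ext_superset:
  assumes "vector_space sc" "finite S" "Poly_Mapping.keys a \<subseteq> S"
  shows "lin_ext sc f a = (\<Sum>b\<in>S. sc (Poly_Mapping.lookup a b) (f b))"
proof -
  interpret vector_space sc by fact
  show ?thesis unfolding lin_ext_def
    by (rule sum.mono_neutral_left) (use assms in \<open>auto simp: in_keys_iff\<close>)
qed

lemma lin_ext_add:
  assumes "vector_space sc" shows "lin_ext sc f (a + b) = lin_ext sc f a + lin_ext sc f b"
proof -
  interpret vector_space sc by fact
  let ?S = "Poly_Mapping.keys a \<union> Poly_Mapping.keys b"
  have "Poly_Mapping.keys (a + b) \<subseteq> ?S" by (rule Poly_Mapping.keys_add)
  then show ?thesis
    by (simp add: lin_ext_superset[OF assms, of ?S] lookup_add scale_left_distrib sum.distrib)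
qed

lemma lin_ext_scale:
  assumes "vector_space sc" shows "lin_ext sc f (ramond_scale c a) = sc c (lin_ext sc f a)"
proof -
  interpret vector_space sc by fact
  let ?S = "Poly_Mapping.keys a"
  have "Poly_Mapping.keys (ramond_scale c a) \<subseteq> ?S" by (auto simp: in_keys_iff)
  then show ?thesis
    by (simp add: lin_ext_superset[OF assms, of ?S] scale_sum_right)
qed

lemma lin_ext_single:
  assumes "vector_space sc" shows "lin_ext sc f (Poly_Mapping.single b c) = sc c (f b)"
proof -
  interpret vector_space sc by fact
  show ?thesis by (cases "c = 0") (simp_all add: lin_ext_def)
qed

lemma ramond_bracket_add_left: "ramond_bracket (a + a') b = ramond_bracket a b + ramond_bracket a' b"
  by (simp add: ramond_bracket_def lin_ext_add[OF vector_space_ramond])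
lemma ramond_bracket_scale_left: "ramond_bracket (ramond_scale c a) b = ramond_scale c (ramond_bracket a b)"
  by (simp add: ramond_bracket_def lin_ext_scale[OF vector_space_ramond])
lemma ramond_bracket_add_right: "ramond_bracket a (b + b') = ramond_bracket a b + ramond_bracket a b'"
  unfolding ramond_bracket_def lin_ext_add[OF vector_space_ramond]
  unfolding lin_ext_def by (simp add: ramond.scale_right_distrib sum.distrib)
lemma ramond_bracket_scale_right: "ramond_bracket a (ramond_scale c b) = ramond_scale c (ramond_bracket a b)"
  unfolding ramond_bracket_def lin_ext_scale[OF vector_space_ramond]
  unfolding lin_ext_def by (simp add: ramond.scale_sum_right ac_simps)
lemma ramond_bracket_single: "ramond_bracket (ramond_term c i) (ramond_term d j) = ramond_scale (c*d) (basis_bracket i j)"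
  by (simp add: ramond_bracket_def lin_ext_single[OF vector_space_ramond])

lemma linear_ramond_bracket_left: "Vector_Spaces.linear ramond_scale ramond_scale (\<lambda>a. ramond_bracket a b)"
  by unfold_locales (simp_all add: ramond_bracket_add_left ramond_bracket_scale_left)
lemma linear_ramond_bracket_right: "Vector_Spaces.linear ramond_scale ramond_scale (ramond_bracket a)"
  by unfold_locales (simp_all add: ramond_bracket_add_right ramond_bracket_scale_right)

lemma ramond_scale_term: "ramond_scale c (ramond_term d b) = ramond_term (c*d) b"
  by (auto intro!: poly_mapping_eqI simp: lookup_single when_def)

lemma ramond_bracket_diff_left: "ramond_bracket (a - a') b = ramond_bracket a b - ramond_bracket a' b"
  using ramond_bracket_add_left[of "a-a'" a' b] by simp
lemma ramond_bracket_diff_right: "ramond_bracket b (a - a') = ramond_bracket b a - ramond_bracket b a'"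
  using ramond_bracket_add_right[of b "a-a'" a'] by simp
lemma ramond_bracket_0: "ramond_bracket 0 b = 0" "ramond_bracket b 0 = 0"
  using ramond_bracket_add_left[of 0 0 b] ramond_bracket_add_right[of b 0 0] by simp_all

lemma ramond_term_sum: "a = (\<Sum>b\<in>Poly_Mapping.keys a. ramond_scale (Poly_Mapping.lookup a b) (ramond_term 1 b))"
  by (rule poly_mapping_eqI) (simp add: lookup_sum lookup_single when_def in_keys_iff if_distrib cong: if_cong)

lemma ramond_part_induct [consumes 1, case_names zero single scale add]:
  assumes "a \<in> ramond_part i" "P 0"
    "\<And>b. parity b = i \<Longrightarrow> P (ramond_term 1 b)"
    "\<And>c a. P a \<Longrightarrow> P (ramond_scale c a)" "\<And>a b. P a \<Longrightarrow> P b \<Longrightarrow> P (a + b)"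
  shows "P a"
proof -
  have a: "a = (\<Sum>b\<in>Poly_Mapping.keys a. ramond_scale (Poly_Mapping.lookup a b) (ramond_term 1 b))"
    by (rule ramond_term_sum)
  have "finite S \<Longrightarrow> S \<subseteq> Poly_Mapping.keys a \<Longrightarrow>
     P (\<Sum>b\<in>S. ramond_scale (Poly_Mapping.lookup a b) (ramond_term 1 b))" for S
    by (induction S rule: finite_induct) (use assms in \<open>auto simp: ramond_part_def\<close>)
  from this[of "Poly_Mapping.keys a"] a show ?thesis by simp
qed

lemma ramond_induct:
  assumes "P 0" "\<And>b. P (ramond_term 1 b)"
    "\<And>c a. P a \<Longrightarrow> P (ramond_scale c a)" "\<And>a b. P a \<Longrightarrow> P b \<Longrightarrow> P (a + b)"
  shows "P a"
proof -
  have a: "a = (\<Sum>b\<in>Poly_Mapping.keys a. ramond_scale (Poly_Mapping.lookup a b) (ramond_term 1 b))"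
    by (rule ramond_term_sum)
  have "finite S \<Longrightarrow> 
     P (\<Sum>b\<in>S. ramond_scale (Poly_Mapping.lookup a b) (ramond_term 1 b))" for S
    by (induction S rule: finite_induct) (use assms in auto)
  from this[of "Poly_Mapping.keys a"] a show ?thesis by simp
qed

lemma basis_bracket_skew: "basis_bracket a b = ramond_scale (- super_sign (parity a) (parity b)) (basis_bracket b a)"
  by (cases a; cases b) (auto intro!: poly_mapping_eqI simp: super_sign_def lookup_add lookup_minus lookup_single when_def algebra_simps add_eq_0_iff power3_eq_cube)

lemma basis_bracket_parity: "basis_bracket a b \<in> ramond_part (parity a + parity b)"
  by (cases a; cases b) (auto simp: ramond_part_def in_keys_iff lookup_add lookup_minus lookup_single when_def split: if_splits)

lemma int_sum3_zero: "a + (b + c) = 0 \<Longrightarrow> a = - b - c" for a :: int by simp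

lemma basis_bracket_jacobi:
  "ramond_bracket (ramond_term 1 a) (ramond_bracket (ramond_term 1 b) (ramond_term 1 c)) =
   ramond_bracket (ramond_bracket (ramond_term 1 a) (ramond_term 1 b)) (ramond_term 1 c) +
   ramond_scale (super_sign (parity a) (parity b)) (ramond_bracket (ramond_term 1 b) (ramond_bracket (ramond_term 1 a) (ramond_term 1 c)))"
  apply (cases a; cases b; cases c; simp add: ramond_bracket_single ramond_bracket_add_left ramond_bracket_add_right ramond_bracket_diff_left ramond_bracket_diff_right ramond_bracket_0 super_sign_def ramond_scale_term ramond.scale_right_distrib ramond.scale_right_diff_distrib add_ac single_add[symmetric] single_diff[symmetric];
    (rule arg_cong[where f="\<lambda>c. ramond_term c _"], simp add: field_simps; fail)?;
    (intro conjI impI)?; (drule int_sum3_zero, hypsubst)?;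
    (rule poly_mapping_eqI)?; (simp add: lookup_add lookup_minus lookup_single when_def; fail)?;
    (simp add: lookup_add lookup_minus lookup_single when_def field_simps power2_eq_square power3_eq_cube; fail)?)
  done

lemma super_vector_space_ramond: "super_vector_space ramond_scale ramond_part"
proof
  show sub: "ramond.subspace (ramond_part i)" for i
    by (auto simp: ramond.subspace_def ramond_part_def in_keys_iff lookup_add) 
  show "\<exists>v0\<in>ramond_part 0. \<exists>v1\<in>ramond_part 1. v = v0 + v1" for v :: ramond
  proof (induction v rule: ramond_induct)
    case 1
    show ?case by (intro bexI[of _ 0]) (auto simp: ramond_part_def)
  next
    case (2 b)
    show ?case
    proof (cases "parity b = 0")
      case True
      then show ?thesis
        by (intro bexI[of _ "ramond_term 1 b"] bexI[of _ 0]) (auto simp: ramond_part_def)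
    next
      case False
      then show ?thesis
        by (intro bexI[of _ 0] bexI[of _ "ramond_term 1 b"]) (auto simp: ramond_part_def)
    qed
  next
    case (3 c a)
    then obtain v0 v1 where "v0 \<in> ramond_part 0" "v1 \<in> ramond_part 1" "a = v0 + v1" by blast
    then show ?case
      using sub[of 0] sub[of 1]
      by (metis ramond.scale_right_distrib ramond.subspace_scale)
  next
    case (4 a b)
    then obtain v0 v1 w0 w1 where "v0 \<in> ramond_part 0" "v1 \<in> ramond_part 1" "a = v0 + v1"
       "w0 \<in> ramond_part 0" "w1 \<in> ramond_part 1" "b = w0 + w1" by blast
    then show ?case
      using sub[of 0] sub[of 1]
      by (intro bexI[of _ "v0 + w0"] bexI[of _ "v1 + w1"]) (auto intro: ramond.subspace_add)
  qed
  show "ramond_part 0 \<inter> ramond_part 1 = {0}"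
  proof (intro equalityI subsetI)
    fix a assume "a \<in> ramond_part 0 \<inter> ramond_part 1"
    then have "Poly_Mapping.keys a = {}" by (fastforce simp: ramond_part_def)
    then show "a \<in> {0}" by simp
  qed (simp add: ramond_part_def)
qed

theorem lie_superalgebra_ramond: "lie_superalgebra ramond_scale ramond_part ramond_bracket"
proof -
  interpret super_vector_space ramond_scale ramond_part by (rule super_vector_space_ramond)
  note sub = subspace_part
  show ?thesis
  proof (intro lie_superalgebra.intro lie_superalgebra_axioms.intro
      super_vector_space_ramond linear_ramond_bracket_left linear_ramond_bracket_right)
    fix i j and a b c :: ramond
    assume a: "a \<in> ramond_part i" and b: "b \<in> ramond_part j"
    from a b show "ramond_bracket a b \<in> ramond_part (i + j)"
    proof (induction a arbitrary: b rule: ramond_part_induct)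
      case (single x)
      from single(2,1) show ?case
      proof (induction b rule: ramond_part_induct)
        case (single y)
        then show ?case using basis_bracket_parity[of x y] by (simp only: ramond_bracket_single) simp
      qed (auto simp: ramond_bracket_0 ramond_bracket_add_right ramond_bracket_scale_right
              intro: ramond.subspace_0 ramond.subspace_add ramond.subspace_scale sub)
    qed (auto simp: ramond_bracket_0 ramond_bracket_add_left ramond_bracket_scale_left
              intro: ramond.subspace_0 ramond.subspace_add ramond.subspace_scale sub)
    from a b show "ramond_bracket a b = ramond_scale (- super_sign i j) (ramond_bracket b a)"
    proof (induction a arbitrary: b rule: ramond_part_induct)
      case (single x)
      from single(2,1) show ?case
        by (induction b rule: ramond_part_induct)
           (auto simp: ramond_bracket_0 ramond_bracket_single ramond_bracket_add_right ramond_bracket_scale_right ramond_bracket_add_left ramond_bracket_scale_left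
              basis_bracket_skew[of x] ramond.scale_right_distrib mult.commute)
    qed (auto simp: ramond_bracket_0 ramond_bracket_add_right ramond_bracket_scale_right ramond_bracket_add_left ramond_bracket_scale_left
          ramond.scale_right_distrib mult.commute)
    from a b show "ramond_bracket a (ramond_bracket b c) = ramond_bracket (ramond_bracket a b) c +
      ramond_scale (super_sign i j) (ramond_bracket b (ramond_bracket a c))"
    proof (induction a arbitrary: b rule: ramond_part_induct)
      case (single x)
      note x = single(1)
      from single(2) show ?case
      proof (induction b rule: ramond_part_induct)
        case (single y)
        then show ?case
          by (induction c rule: ramond_induct)
             (use x basis_bracket_jacobi[of x y] in \<open>auto simp: ramond_bracket_0 ramond_bracket_add_right ramond_bracket_scale_right ramond_bracket_add_left
                ramond_bracket_scale_left ramond.scale_right_distrib mult.commute\<close>)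
      qed (auto simp: ramond_bracket_0 ramond_bracket_add_right ramond_bracket_scale_right ramond_bracket_add_left ramond_bracket_scale_left
            ramond.scale_right_distrib mult.commute)
    qed (auto simp: ramond_bracket_0 ramond_bracket_add_right ramond_bracket_scale_right ramond_bracket_add_left ramond_bracket_scale_left
            ramond.scale_right_distrib mult.commute)
  qed
qed


section \<open>Polynomials in two variables\<close>

text \<open>The polynomial ring in two variables is the iterated one: the first variable
  (\<open>x\<close> or \<open>s\<close>) is the inner one, the second (\<open>y\<close> or \<open>t\<close>) the outer one.
  Hence the coefficient of \<open>x^j y^i\<close> in \<open>f\<close> is \<open>coeff (coeff f i) j\<close>.\<close>

type_synonym poly2 = "complex poly poly"

abbreviation const2 :: "complex \<Rightarrow> poly2" where "const2 c \<equiv> [:[:c:]:]"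

abbreviation var1 :: poly2 where "var1 \<equiv> [:[:0, 1:]:]"

abbreviation var2 :: poly2 where "var2 \<equiv> [:0, 1:]"

text \<open>\<open>subst2 f p q\<close> is \<open>f(p, q)\<close>.\<close>

definition subst2 :: "poly2 \<Rightarrow> poly2 \<Rightarrow> poly2 \<Rightarrow> poly2" where
  "subst2 f p q = poly (map_poly (\<lambda>h. poly (map_poly const2 h) p) f) q"

text \<open>\<open>poly2_op scale A B p\<close> is the operator \<open>p(A, B)\<close>, for commuting operators \<open>A\<close>, \<open>B\<close>.\<close>

definition poly2_op ::
  "(complex \<Rightarrow> 'v::ab_group_add \<Rightarrow> 'v) \<Rightarrow> ('v \<Rightarrow> 'v) \<Rightarrow> ('v \<Rightarrow> 'v) \<Rightarrow> poly2 \<Rightarrow> 'v \<Rightarrow> 'v" where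
  "poly2_op scale A B p v =
    (\<Sum>i\<le>degree p. \<Sum>j\<le>degree (coeff p i).
       scale (coeff (coeff p i) j) ((A ^^ j) ((B ^^ i) v)))"

definition free_module_of_rank :: "('r::comm_ring_1 \<Rightarrow> 'v::ab_group_add \<Rightarrow> 'v) \<Rightarrow> nat \<Rightarrow> bool" where
  "free_module_of_rank scale n \<longleftrightarrow>
    module scale \<and>
    (\<exists>B. finite B \<and> card B = n \<and> \<not> module.dependent scale B \<and> module.span scale B = UNIV)"


section \<open>The space \<open>\<Omega>(\<lambda>, \<alpha>)\<close>\<close>

text \<open>A pair \<open>(f, g)\<close> stands for \<open>f(x, y) + g(s, t)\<close>.\<close>

type_synonym omega = "poly2 \<times> poly2"

definition omega_scale :: "complex \<Rightarrow> omega \<Rightarrow> omega" where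
  "omega_scale c = (\<lambda>(f, g). (const2 c * f, const2 c * g))"

definition omega_part :: "bit \<Rightarrow> omega set" where
  "omega_part i = (if i = 0 then UNIV \<times> {0} else {0} \<times> UNIV)"

fun omega_basis_act :: "complex \<Rightarrow> complex \<Rightarrow> ramond_basis \<Rightarrow> omega \<Rightarrow> omega" where
  "omega_basis_act l \<alpha> (Lgen m) (f, g) =
    (const2 (l powi m) * (var1 + const2 (of_int m / 2) * var2) *
       subst2 f (var1 + const2 (of_int m)) var2,
     const2 (l powi m) * (var1 + const2 (of_int m / 2) * var2 + const2 (of_int m)) *
       subst2 g (var1 + const2 (of_int m)) var2)"
| "omega_basis_act l \<alpha> (Hgen m) (f, g) =
    (const2 (l powi m) * var2 * subst2 f (var1 + const2 (of_int m)) var2,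
     const2 (l powi m) * var2 * subst2 g (var1 + const2 (of_int m)) var2)"
| "omega_basis_act l \<alpha> (Gplus m) (f, g) =
    (const2 (l powi m * (2 / \<alpha>)) * (var1 + const2 (of_int m) * var2) *
       subst2 g (var1 + const2 (of_int m)) (var2 - const2 1),
     0)"
| "omega_basis_act l \<alpha> (Gminus m) (f, g) =
    (0,
     const2 (l powi m * \<alpha>) * subst2 f (var1 + const2 (of_int m)) (var2 + const2 1))"
| "omega_basis_act l \<alpha> Cgen (f, g) = (0, 0)"

definition omega_act :: "complex \<Rightarrow> complex \<Rightarrow> ramond \<Rightarrow> omega \<Rightarrow> omega" where
  "omega_act l \<alpha> a v = lin_ext omega_scale (\<lambda>b. omega_basis_act l \<alpha> b v) a"

text \<open>The restriction of the action to \<open>U(\<hh>) = \<complex>[L\<^sub>0, H\<^sub>0]\<close>.\<close>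

definition omega_cartan_act :: "complex \<Rightarrow> complex \<Rightarrow> poly2 \<Rightarrow> omega \<Rightarrow> omega" where
  "omega_cartan_act l \<alpha> =
    poly2_op omega_scale
      (omega_act l \<alpha> (ramond_term 1 (Lgen 0))) (omega_act l \<alpha> (ramond_term 1 (Hgen 0)))"

end

theory Submission
  imports Defs
begin

text \<open>Both sides of the module identity are bilinear, so it suffices to check it on pairs of
  basis vectors of the algebra. Since \<open>f \<mapsto> f(p, q)\<close> is a ring homomorphism and substitutions compose,
  each such pair shifts \<open>f\<close> in the same way on both sides, and what remains is an identity
  between the polynomial prefactors. Freeness holds because \<open>L\<^sub>0\<close> and \<open>H\<^sub>0\<close> act as multiplication
  by the two variables, so that \<open>(1, 0)\<close> and \<open>(0, 1)\<close> form a basis.\<close>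

section \<open>Substitution in bivariate polynomials\<close>

text \<open>Opaque names for the scalars and the variables keep the simplifier from merging
  them into single coefficient lists.\<close>

definition cst :: "complex \<Rightarrow> poly2" where "cst c = const2 c"

definition varX :: poly2 where "varX = var1"

definition varY :: poly2 where "varY = var2"

lemma cst_simps:
  "cst 0 = 0" "cst 1 = 1" "cst (a + b) = cst a + cst b" "cst (a - b) = cst a - cst b"
  "cst (- a) = - cst a" "cst (a * b) = cst a * cst b"
  by (simp_all add: cst_def one_pCons)

lemma cst_of_int: "cst (of_int m) = of_int m"
  by (simp add: cst_def of_int_poly)

text \<open>Splitting off \<open>cst (1/2)\<close> turns the half-integers in the prefactors of
  \<open>Lgen\<close> into ring integers times one fixed constant.\<close>

lemma cst_of_int_half: "cst (of_int m / 2) = cst (1/2) * of_int m"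
  using cst_simps(6)[of "1/2" "of_int m"] by (simp add: cst_of_int)

lemma cst_numeral: "cst (numeral n) = numeral n"
  using cst_of_int[of "numeral n"] by simp

lemma subst2_0 [simp]: "subst2 0 p q = 0"
  by (simp add: subst2_def)

lemma subst2_pCons:
  "subst2 (pCons h f) p q = poly (map_poly const2 h) p + q * subst2 f p q"
  by (simp add: subst2_def map_poly_pCons)

text \<open>\<open>poly (map_poly const2 h) p\<close> is h(p) for a polynomial h in the first
  variable alone. \<open>subst2\<close> applies it to every coefficient, so its homomorphism laws
  come first.\<close>

lemma eval_const2_pCons:
  "poly (map_poly const2 (pCons a h)) p = cst a + p * poly (map_poly const2 h) p"
  by (simp add: map_poly_pCons cst_def)

lemma eval_const2_add:
  "poly (map_poly const2 (h + k)) p = poly (map_poly const2 h) p + poly (map_poly const2 k) p"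
  by (induction h k rule: poly_induct2) (simp_all add: map_poly_pCons algebra_simps)

lemma eval_const2_smult:
  "poly (map_poly const2 (smult c h)) p = cst c * poly (map_poly const2 h) p"
  by (induction h)
    (simp_all add: map_poly_pCons algebra_simps cst_def flip: smult_smult)

lemma eval_const2_mult:
  "poly (map_poly const2 (h * k)) p = poly (map_poly const2 h) p * poly (map_poly const2 k) p"
  by (induction h)
    (simp_all add: map_poly_pCons eval_const2_add eval_const2_smult cst_def algebra_simps)

lemma subst2_add: "subst2 (f + g) p q = subst2 f p q + subst2 g p q"
  by (induction f g rule: poly_induct2) (simp_all add: subst2_pCons eval_const2_add algebra_simps)

text \<open>A scalar of the outer polynomial ring is itself a polynomial in the first variable, so
  it gets evaluated too. This is the inductive step of multiplicativity.\<close>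

lemma subst2_smult: "subst2 (smult h f) p q = poly (map_poly const2 h) p * subst2 f p q"
  by (induction f) (simp_all add: subst2_pCons eval_const2_mult algebra_simps)

lemma subst2_mult: "subst2 (f * g) p q = subst2 f p q * subst2 g p q"
  by (induction f) (simp_all add: subst2_pCons subst2_add subst2_smult algebra_simps)

lemma subst2_cst: "subst2 (cst c) p q = cst c"
  by (simp add: cst_def subst2_pCons map_poly_pCons)

lemma subst2_1: "subst2 1 p q = 1"
  using subst2_cst[of 1] by (simp add: cst_simps)

lemma subst2_varX: "subst2 varX p q = p"
  by (simp add: varX_def subst2_pCons eval_const2_pCons cst_simps)

lemma subst2_varY: "subst2 varY p q = q"
  by (simp add: varY_def subst2_pCons map_poly_pCons pCons_one subst2_1)

lemma subst2_diff: "subst2 (f - g) p q = subst2 f p q - subst2 g p q"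
  using subst2_add[of "f - g" g p q] by simp

lemma pCons_conv_varX: "[:pCons c h:] = cst c + varX * [:h:]"
  by (simp add: cst_def varX_def)

lemma pCons_conv_varY: "pCons h f = [:h:] + varY * f"
  by (simp add: varY_def)

lemma subst2_coeff_compose:
  "poly (map_poly const2 h) (subst2 p p' q') = subst2 (poly (map_poly const2 h) p) p' q'"
  by (induction h)
    (simp_all add: eval_const2_pCons subst2_add subst2_mult subst2_cst)

text \<open>Horner's scheme commutes with the ring homomorphism given by (p', q'). This merges the
  shifts of two successive basis operators into one.\<close>

lemma subst2_subst2:
  "subst2 (subst2 f p q) p' q' = subst2 f (subst2 p p' q') (subst2 q p' q')"
  by (induction f) (simp_all add: subst2_pCons subst2_add subst2_mult subst2_coeff_compose)

lemma subst2_id: "subst2 f varX varY = f"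
proof -
  have "poly (map_poly const2 h) varX = [:h:]" for h
  proof (induction h)
    case (pCons a h)
    then show ?case unfolding eval_const2_pCons pCons_conv_varX[of a] by simp
  qed simp
  then show ?thesis
    by (induction f) (simp_all add: subst2_pCons flip: pCons_conv_varY)
qed

lemmas subst2_simps = subst2_add subst2_diff subst2_mult subst2_cst subst2_varX subst2_varY
  subst2_subst2


section \<open>The supermodule axioms\<close>

lemma omega_scale_Pair: "omega_scale c (f, g) = (cst c * f, cst c * g)"
  by (simp add: omega_scale_def cst_def)

lemma vector_space_omega: "vector_space omega_scale"
  by unfold_locales (auto simp: omega_scale_Pair cst_simps algebra_simps)

interpretation omega: vector_space omega_scale by (rule vector_space_omega)

lemma omega_basis_act_conv:
  "omega_basis_act l \<alpha> (Lgen m) (f, g) =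
    (cst (l powi m) * (varX + cst (1/2) * of_int m * varY) * subst2 f (varX + of_int m) varY,
     cst (l powi m) * (varX + cst (1/2) * of_int m * varY + of_int m) *
       subst2 g (varX + of_int m) varY)"
  "omega_basis_act l \<alpha> (Hgen m) (f, g) =
    (cst (l powi m) * varY * subst2 f (varX + of_int m) varY,
     cst (l powi m) * varY * subst2 g (varX + of_int m) varY)"
  "omega_basis_act l \<alpha> (Gplus m) (f, g) =
    (cst (l powi m) * cst (2 / \<alpha>) * (varX + of_int m * varY) *
       subst2 g (varX + of_int m) (varY - 1), 0)"
  "omega_basis_act l \<alpha> (Gminus m) (f, g) =
    (0, cst (l powi m) * cst \<alpha> * subst2 f (varX + of_int m) (varY + 1))"
  unfolding omega_basis_act.simps cst_def[symmetric] varX_def[symmetric] varY_def[symmetric]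
    cst_of_int_half
  by (simp_all add: cst_of_int cst_simps del: times_divide_eq_right)

lemma omega_basis_act_Cgen: "omega_basis_act l \<alpha> Cgen v = 0"
  by (cases v) (simp add: zero_prod_def)

lemma subst2_of_int: "subst2 (of_int m) p q = of_int m"
  using subst2_cst[of "of_int m"] by (simp add: cst_of_int)

section \<open>Bilinearity of the action\<close>

lemma omega_basis_act_add:
  "omega_basis_act l \<alpha> b (v + w) = omega_basis_act l \<alpha> b v + omega_basis_act l \<alpha> b w"
  by (cases v; cases w; cases b)
    (simp_all add: omega_basis_act_conv omega_basis_act_Cgen subst2_simps algebra_simps del: omega_basis_act.simps)

lemma omega_basis_act_scale:
  "omega_basis_act l \<alpha> b (omega_scale c v) = omega_scale c (omega_basis_act l \<alpha> b v)"
  by (cases v; cases b)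
    (simp_all add: omega_basis_act_conv omega_basis_act_Cgen omega_scale_Pair subst2_simps del: omega_basis_act.simps)

lemma omega_act_add_left: "omega_act l \<alpha> (a + b) v = omega_act l \<alpha> a v + omega_act l \<alpha> b v"
  by (simp add: omega_act_def lin_ext_add[OF vector_space_omega])

lemma omega_act_scale_left: "omega_act l \<alpha> (ramond_scale c a) v = omega_scale c (omega_act l \<alpha> a v)"
  by (simp add: omega_act_def lin_ext_scale[OF vector_space_omega])

lemma omega_act_add_right: "omega_act l \<alpha> a (v + w) = omega_act l \<alpha> a v + omega_act l \<alpha> a w"
  by (simp add: omega_act_def lin_ext_def omega_basis_act_add omega.scale_right_distrib sum.distrib)

lemma omega_act_scale_right: "omega_act l \<alpha> a (omega_scale c v) = omega_scale c (omega_act l \<alpha> a v)"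
  by (simp add: omega_act_def lin_ext_def omega_basis_act_scale omega.scale_sum_right ac_simps)

lemma omega_act_term: "omega_act l \<alpha> (ramond_term c b) v = omega_scale c (omega_basis_act l \<alpha> b v)"
  by (simp add: omega_act_def lin_ext_single[OF vector_space_omega])

lemma omega_act_diff_left: "omega_act l \<alpha> (a - b) v = omega_act l \<alpha> a v - omega_act l \<alpha> b v"
  using omega_act_add_left[of l \<alpha> "a - b" b v] by simp

lemma omega_act_0_left: "omega_act l \<alpha> 0 v = 0"
  using omega_act_add_left[of l \<alpha> 0 0 v] by simp

lemma omega_act_0_right: "omega_act l \<alpha> a 0 = 0"
  using omega_act_add_right[of l \<alpha> a 0 0] by simp

text \<open>Shifts of the first variable by m and n add up to m + n, and \<open>C\<close> acts as
  zero. For \<open>Gminus r\<close> with \<open>Gplus s\<close> one of the two orders vanishes on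
  each component and the shifts of the second variable cancel in the other. Apart from the power of
  l, the prefactor is 2(x + s y) on the even part; on the odd part \<open>Gminus r\<close> acts last
  and shifts it to 2(x + r + s + s y), whence the extra summand m in the odd action of
  \<open>Lgen m\<close>.\<close>

lemma omega_basis_act_bracket:
  assumes "l \<noteq> 0" "\<alpha> \<noteq> 0"
  shows "omega_act l \<alpha> (basis_bracket a b) v =
    omega_basis_act l \<alpha> a (omega_basis_act l \<alpha> b v) -
    omega_scale (super_sign (parity a) (parity b))
      (omega_basis_act l \<alpha> b (omega_basis_act l \<alpha> a v))"
proof -
  obtain f g where v: "v = (f, g)" by force
  have powi: "cst (l powi (m + n)) = cst (l powi m) * cst (l powi n)" for m n
    using assms by (simp add: power_int_add cst_simps)
  have half: "2 * cst (1/2) = 1"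
    using cst_simps(6)[of 2 "1/2"] by (simp add: cst_numeral cst_simps)
  \<comment> \<open>Writing each integer as twice its half \<open>e m\<close> absorbs the constant
    \<open>cst (1/2)\<close>, leaving identities with integer coefficients.\<close>
  define e :: "int \<Rightarrow> poly2" where "e m = cst (1/2) * of_int m" for m
  have of_int_e: "of_int m = 2 * e m" for m
    using half unfolding e_def by (metis mult.assoc mult_1)
  have half_mult: "cst (1/2) * (2 * p) = p" "cst (1/2) * (2 * p + 2 * q) = p + q" for p q
    by (metis half mult.assoc mult.commute mult_1,
        metis half mult.assoc mult.commute mult_1 distrib_left)
  have two_div: "cst (2 / \<alpha>) = 2 * cst (1 / \<alpha>)"
    using cst_simps(6)[of 2 "1 / \<alpha>"] by (simp add: cst_numeral)
  have "cst \<alpha> * cst (1 / \<alpha>) = 1"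
    using assms cst_simps(6)[of \<alpha> "1 / \<alpha>"] by (simp add: cst_simps)
  then have inv: "cst \<alpha> * (cst (1 / \<alpha>) * r) = r" for r
    by (simp flip: mult.assoc)
  \<comment> \<open>Sorted products separate the two inverse factors by two or three others.\<close>
  have inv2: "cst \<alpha> * (p * (q * (cst (1 / \<alpha>) * r))) = p * (q * r)" for p q r
  proof -
    have "cst \<alpha> * (p * (q * (cst (1 / \<alpha>) * r))) =
        p * (q * (cst \<alpha> * (cst (1 / \<alpha>) * r)))"
      by (simp only: mult_ac)
    then show ?thesis by (simp only: inv)
  qed
  have inv3: "cst \<alpha> * (p * (q * (s * (cst (1 / \<alpha>) * r)))) = p * (q * (s * r))" for p q r s
    using inv2[of p "q * s" r] by (simp only: mult.assoc)
  \<comment> \<open>Numerals are expanded into repeated sums, so that sorting sums and products can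
    decide the remaining goals.\<close>
  have four: "4 * p = p + p + p + p" for p :: poly2 by simp
  show ?thesis unfolding v
    by (cases a; cases b;
        simp add: omega_basis_act_conv omega_basis_act_Cgen omega_act_add_left omega_act_diff_left
          omega_act_term omega_scale_Pair omega_act_0_left subst2_simps subst2_of_int subst2_1
          super_sign_def cst_simps cst_of_int cst_numeral powi cst_of_int_half zero_prod_def add_ac
          del: omega_basis_act.simps;
        (intro conjI)?; (simp add: of_int_e half_mult algebra_simps; fail)?)
      (simp_all only: of_int_e half_mult two_div, simp_all add: algebra_simps,
       simp_all only: mult_2 four distrib_left distrib_right inv2 inv3 add_ac mult_ac)
qed

lemma super_vector_space_omega: "super_vector_space omega_scale omega_part"
proof
  show "omega.subspace (omega_part i)" for i
    by (auto simp: omega.subspace_def omega_part_def omega_scale_Pair zero_prod_def)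
  show "\<exists>v0\<in>omega_part 0. \<exists>v1\<in>omega_part 1. v = v0 + v1" for v
    by (cases v) (auto simp: omega_part_def)
  show "omega_part 0 \<inter> omega_part 1 = {0}"
    by (auto simp: omega_part_def zero_prod_def)
qed

lemma omega_basis_act_part:
  "v \<in> omega_part j \<Longrightarrow> omega_basis_act l \<alpha> b v \<in> omega_part (parity b + j)"
  by (cases v; cases b) (auto simp: omega_part_def zero_prod_def split: if_splits)

lemma lie_supermodule_omega:
  assumes "l \<noteq> 0" "\<alpha> \<noteq> 0"
  shows "lie_supermodule ramond_scale ramond_part ramond_bracket
    omega_scale omega_part (omega_act l \<alpha>)"
proof (intro lie_supermodule.intro lie_supermodule_axioms.intro lie_superalgebra_ramond
    super_vector_space_omega)
  interpret super_vector_space omega_scale omega_part by (rule super_vector_space_omega)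
  show "Vector_Spaces.linear ramond_scale omega_scale (\<lambda>a. omega_act l \<alpha> a v)" for v
    by unfold_locales (simp_all add: omega_act_add_left omega_act_scale_left)
  show "Vector_Spaces.linear omega_scale omega_scale (omega_act l \<alpha> a)" for a
    by unfold_locales (simp_all add: omega_act_add_right omega_act_scale_right)
  show "omega_act l \<alpha> a v \<in> omega_part (i + j)"
    if "a \<in> ramond_part i" "v \<in> omega_part j" for i j a v
    using that(1)
  proof (induction a rule: ramond_part_induct)
    case (single b)
    then show ?case using omega_basis_act_part[OF that(2), of l \<alpha> b] by (simp add: omega_act_term)
  qed (use subspace_part in \<open>auto simp: omega_act_0_left omega_act_add_left omega_act_scale_left
        intro: omega.subspace_0 omega.subspace_add omega.subspace_scale\<close>)
  fix i j a b v
  assume a: "a \<in> ramond_part i" and b: "b \<in> ramond_part j"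
  note act_simps = ramond_bracket_0 ramond_bracket_add_left ramond_bracket_add_right
    ramond_bracket_scale_left ramond_bracket_scale_right omega_act_0_left omega_act_0_right
    omega_act_add_left omega_act_add_right omega_act_scale_left omega_act_scale_right
    omega.scale_right_distrib omega.scale_right_diff_distrib
  show "omega_act l \<alpha> (ramond_bracket a b) v = omega_act l \<alpha> a (omega_act l \<alpha> b v) -
      omega_scale (super_sign i j) (omega_act l \<alpha> b (omega_act l \<alpha> a v))"
    using a
  \<comment> \<open>The sign depends only on the fixed parities i and j, so on homogeneous parts
    both sides are linear in a and in b.\<close>
  proof (induction a rule: ramond_part_induct)
    case (single x)
    from b show ?case
    proof (induction b rule: ramond_part_induct)
      case (single y)
      then show ?case
        using \<open>parity x = i\<close> omega_basis_act_bracket[OF assms, of x y v]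
        by (simp add: ramond_bracket_single omega_act_term)
    qed (simp_all add: act_simps mult.commute)
  qed (simp_all add: act_simps mult.commute)
qed


section \<open>Freeness over the Cartan subalgebra\<close>

lemma pCons_0_eq_sum:
  "[:h:] = (\<Sum>j\<le>degree h. cst (coeff h j) * varX ^ j)" for h :: "complex poly"
proof -
  have monom: "[:monom c j:] = cst c * varX ^ j" for c j
  proof (induction j)
    case (Suc j)
    then show ?case
      by (simp only: monom_Suc pCons_conv_varX[of 0] cst_simps add_0_left power_Suc mult.left_commute)
  qed (simp add: monom_0 cst_def)
  have sum: "(\<Sum>j\<in>S. [:g j:]) = [:\<Sum>j\<in>S. g j:]"
    for S :: "nat set" and g :: "nat \<Rightarrow> complex poly"
    by (induction S rule: infinite_finite_induct) simp_all
  have "[:h:] = [:\<Sum>j\<le>degree h. monom (coeff h j) j:]"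
    by (simp only: poly_as_sum_of_monoms)
  also have "\<dots> = (\<Sum>j\<le>degree h. [:monom (coeff h j) j:])"
    by (rule sum[symmetric])
  also have "\<dots> = (\<Sum>j\<le>degree h. cst (coeff h j) * varX ^ j)"
    by (simp only: monom)
  finally show ?thesis .
qed

text \<open>The monomial expansion, with the same index ranges as the double sum in
  \<open>poly2_op\<close>, so that operators can replace the variables term by term.\<close>

lemma poly2_eq_sum:
  "p = (\<Sum>i\<le>degree p. \<Sum>j\<le>degree (coeff p i). cst (coeff (coeff p i) j) * varX ^ j * varY ^ i)"
proof -
  have monom: "monom h i = [:h:] * varY ^ i" for h :: "complex poly" and i
  proof (induction i)
    case (Suc i)
    have "pCons 0 (monom h i) = varY * monom h i" by (simp add: varY_def)
    with Suc show ?case by (simp only: monom_Suc power_Suc mult.left_commute)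
  qed (simp add: monom_0)
  have "p = (\<Sum>i\<le>degree p. monom (coeff p i) i)"
    by (rule poly_as_sum_of_monoms[symmetric])
  also have "\<dots> = (\<Sum>i\<le>degree p. \<Sum>j\<le>degree (coeff p i).
      cst (coeff (coeff p i) j) * varX ^ j * varY ^ i)"
    by (intro sum.cong refl) (simp only: monom pCons_0_eq_sum sum_distrib_right)
  finally show ?thesis .
qed

text \<open>At m = 0 the power of l is 1, the shift is trivial and the prefactors reduce to the
  variables, on both the even and the odd part. A polynomial in these two multiplication operators
  is multiplication by that polynomial.\<close>

lemma omega_cartan_act_Pair: "omega_cartan_act l \<alpha> p (f, g) = (p * f, p * g)"
proof -
  let ?L = "omega_act l \<alpha> (ramond_term 1 (Lgen 0))"
  let ?H = "omega_act l \<alpha> (ramond_term 1 (Hgen 0))"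
  have L: "?L (f, g) = (varX * f, varX * g)" and H: "?H (f, g) = (varY * f, varY * g)" for f g
    by (simp_all add: omega_act_term omega_basis_act_conv cst_simps subst2_id
        del: omega_basis_act.simps)
  have Ln: "(?L ^^ n) (f, g) = (varX ^ n * f, varX ^ n * g)" for n f g
    by (induction n) (simp_all add: L ac_simps)
  have Hn: "(?H ^^ n) (f, g) = (varY ^ n * f, varY ^ n * g)" for n f g
    by (induction n) (simp_all add: H ac_simps)
  have "p * h = (\<Sum>i\<le>degree p. \<Sum>j\<le>degree (coeff p i).
      cst (coeff (coeff p i) j) * (varX ^ j * (varY ^ i * h)))" for h
    using arg_cong[OF poly2_eq_sum[of p], of "\<lambda>q. q * h"]
    by (simp only: sum_distrib_right mult.assoc)
  then show ?thesis
    by (simp only: omega_cartan_act_def poly2_op_def Ln Hn omega_scale_Pair sum_prod)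
qed

lemma free_omega_cartan: "free_module_of_rank (omega_cartan_act l \<alpha>) 2"
proof -
  interpret module "omega_cartan_act l \<alpha>"
    by unfold_locales (auto simp: omega_cartan_act_Pair algebra_simps)
  let ?B = "{(1, 0), (0, 1)} :: omega set"
  \<comment> \<open>The combination of (1, 0) and (0, 1) with coefficients f and g is the pair (f,
    g), which gives both independence and spanning.\<close>
  have "\<not> dependent ?B"
    by (subst dependent_finite) (auto simp: omega_cartan_act_Pair zero_prod_def)
  moreover have "(f, g) \<in> span ?B" for f g
  proof -
    have "omega_cartan_act l \<alpha> f (1, 0) + omega_cartan_act l \<alpha> g (0, 1) \<in> span ?B"
      by (intro span_add span_scale span_base) auto
    then show ?thesis by (simp add: omega_cartan_act_Pair)
  qed
  ultimately show ?thesis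
    unfolding free_module_of_rank_def
    by (intro conjI module_axioms exI[of _ ?B]) auto
qed

theorem proposition2p3:
  fixes l \<alpha> :: complex
  assumes "l \<noteq> 0" and "\<alpha> \<noteq> 0"
  shows "lie_supermodule ramond_scale ramond_part ramond_bracket
           omega_scale omega_part (omega_act l \<alpha>)
         \<and> free_module_of_rank (omega_cartan_act l \<alpha>) 2"
  using assms lie_supermodule_omega free_omega_cartan by blast

end
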